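(* Let $F:\mathbb{R}^{m\times n}\to\mathbb{R}^{m\times n}$ satisfy, for constants $\ell\in\mathbb{R}$, $\varepsilon_r\ge0$, $B\in\mathbb{R}$: (a) (one-sided Lipschitz) $\langle X-Y,F(X)-F(Y)\rangle\le\ell\|X-Y\|_F^2$ for all $X,Y\in\mathbb{R}^{m\times n}$; (b) (small normal component) $\|\mathcal{P}_Y[F(Y)]-F(Y)\|_F\le\varepsilon_r$ for all $Y\in\mathcal{M}_r$; (c) (boundedness) $\|F(X)\|_F\le B$ for all $X\in\mathbb{R}^{m\times n}$. Let $A(t)$ be the solution of $\dot A(t)=F(A(t))$, $A(0)=A_0\in\mathbb{R}^{m\times n}$. Then for any solution $Y(t)\in\mathcal{M}_r$, defined on an interval $[0,T]$, of the differential inclusion (DLRA-DEIM) $$Y(0)=Y_0\in\mathcal{M}_r,\qquad\dot Y(t)\in\mathcal{F}(Y(t))\ \text{ for almost every }t\in[0,T],$$ one has, for $t\in[0,T]$, $$\|A(t)-Y(t)\|_F\le e^{\ell t}\|A(0)-Y(0)\|_F+C_{m,r}\,C_{n,r}\,\varepsilon_r\int_0^te^{\ell(t-s)}\,\mathrm{d}s.$$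
   Context: $\mathcal{M}_r=\{X\in\mathbb{R}^{m\times n}\mid\mathrm{rank}(X)=r\}$; $\langle\cdot,\cdot\rangle$ and $\|\cdot\|_F$ are the Frobenius inner product and norm. For $Y=U\Sigma V^\top\in\mathcal{M}_r$ with $U\in\mathbb{R}^{m\times r}$, $V\in\mathbb{R}^{n\times r}$ having orthonormal columns, $\mathcal{P}_Y[Z]=UU^\top Z+ZVV^\top-UU^\top ZVV^\top$ is the orthogonal projection onto the tangent space $T_Y\mathcal{M}_r$. A selection matrix is a matrix whose columns are distinct standard unit vectors. A DEIM procedure is a rule assigning to each $U\in\mathbb{R}^{m\times r}$ with orthonormal columns a selection matrix $S_U\in\mathbb{R}^{m\times r}$ with $S_U^\top U$ invertible and $\|(S_U^\top U)^{-1}\|_2\le C_{m,r}$, and to each $V\in\mathbb{R}^{n\times r}$ with orthonormal columns a selection matrix $S_V\in\mathbb{R}^{n\times r}$ with $S_V^\top V$ invertible and $\|(S_V^\top V)^{-1}\|_2\le C_{n,r}$, where $C_{m,r},C_{n,r}$ are constants. For $Y=U\Sigma V^\top\in\mathcal{M}_r$ define $$\mathcal{P}^{\angle}_Y[Z]=P_U^{\angle}Z-P_U^{\angle}ZP_V^{\vee}+ZP_V^{\vee},\qquad P_U^{\angle}=U(S_U^\top U)^{-1}S_U^\top,\quad P_V^{\vee}=S_V(V^\top S_V)^{-1}V^\top.$$ It is assumed that $f(Y)=\mathcal{P}^{\angle}_Y[F(Y)]$ is well defined as a function of $Y\in\mathcal{M}_r$. With $\mathcal{B}=\{X\in\mathbb{R}^{m\times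 n}:\|X\|_F\le1\}$ set $$\mathcal{F}(Y)=\bigcap_{\epsilon>0}\overline{\mathrm{conv}}\big[f\big((Y+\epsilon\mathcal{B})\cap\mathcal{M}_r\big)\big],\quad Y\in\mathcal{M}_r,$$ where $\overline{\mathrm{conv}}$ denotes the closed convex hull. A solution of the differential inclusion on $[0,T]$ is an absolutely continuous function $Y:[0,T]\to\mathcal{M}_r$ satisfying the initial condition and the inclusion for almost every $t$. *)

theory Defs
  imports "HOL-Analysis.Analysis"
begin

text \<open>
  The space of real \<open>m \<times> n\<close> matrices is \<^typ>\<open>real^'n^'m\<close>. The inner product and the norm which
  this type inherits from the type class hierarchy are the Frobenius ones.
\<close>

lemma inner_matrix_eq_Frobenius:
  fixes X Y :: "real^'n^'m"
  shows "X \<bullet> Y = (\<Sum>i\<in>UNIV. \<Sum>j\<in>UNIV. X $ i $ j * Y $ i $ j)"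
  by (simp add: inner_vec_def)

lemma norm_matrix_eq_Frobenius:
  fixes X :: "real^'n^'m"
  shows "norm X = sqrt (\<Sum>i\<in>UNIV. \<Sum>j\<in>UNIV. (X $ i $ j)\<^sup>2)"
  by (simp add: norm_eq_sqrt_inner inner_vec_def power2_eq_square)

definition fixed_rank :: "nat \<Rightarrow> (real^'n^'m) set"
  where "fixed_rank r = {X. rank X = r}"

definition orthonormal_columns :: "real^'r^'m \<Rightarrow> bool"
  where "orthonormal_columns U \<longleftrightarrow> transpose U ** U = mat 1"

text \<open>
  The middle factor is an arbitrary \<open>r \<times> r\<close> matrix; since \<open>Y\<close> has rank \<open>r\<close>, it is invertible,
  but it need not be diagonal.
\<close>

definition low_rank_factorization ::
    "real^'n^'m \<Rightarrow> real^'r^'m \<Rightarrow> real^'r^'r \<Rightarrow> real^'r^'n \<Rightarrow> bool"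
  where "low_rank_factorization Y U \<Sigma> V \<longleftrightarrow>
    Y \<in> fixed_rank CARD('r) \<and> orthonormal_columns U \<and> orthonormal_columns V \<and>
    Y = U ** \<Sigma> ** transpose V"

definition tangent_projection :: "real^'r^'m \<Rightarrow> real^'r^'n \<Rightarrow> real^'n^'m \<Rightarrow> real^'n^'m"
  where "tangent_projection U V Z =
    U ** transpose U ** Z + Z ** V ** transpose V - U ** transpose U ** Z ** V ** transpose V"

definition selection_matrix :: "real^'r^'m \<Rightarrow> bool"
  where "selection_matrix S \<longleftrightarrow> (\<exists>p. inj p \<and> (\<forall>j. column j S = axis (p j) 1))"

definition spectral_norm :: "real^'n^'m \<Rightarrow> real"
  where "spectral_norm A = onorm ((*v) A)"

definition deim_procedure :: "(real^'r^'m \<Rightarrow> real^'r^'m) \<Rightarrow> real \<Rightarrow> bool"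
  where "deim_procedure S C \<longleftrightarrow>
    (\<forall>U. orthonormal_columns U \<longrightarrow>
       selection_matrix (S U) \<and> invertible (transpose (S U) ** U) \<and>
       spectral_norm (matrix_inv (transpose (S U) ** U)) \<le> C)"

definition deim_left :: "(real^'r^'m \<Rightarrow> real^'r^'m) \<Rightarrow> real^'r^'m \<Rightarrow> real^'m^'m"
  where "deim_left S U = U ** matrix_inv (transpose (S U) ** U) ** transpose (S U)"

definition deim_right :: "(real^'r^'n \<Rightarrow> real^'r^'n) \<Rightarrow> real^'r^'n \<Rightarrow> real^'n^'n"
  where "deim_right S V = S V ** matrix_inv (transpose V ** S V) ** transpose V"

definition deim_projection ::
    "(real^'r^'m \<Rightarrow> real^'r^'m) \<Rightarrow> (real^'r^'n \<Rightarrow> real^'r^'n) \<Rightarrow>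
     real^'r^'m \<Rightarrow> real^'r^'n \<Rightarrow> real^'n^'m \<Rightarrow> real^'n^'m"
  where "deim_projection S\<^sub>U S\<^sub>V U V Z =
    deim_left S\<^sub>U U ** Z - deim_left S\<^sub>U U ** Z ** deim_right S\<^sub>V V + Z ** deim_right S\<^sub>V V"

text \<open>
  Set-valued regularization of \<open>f\<close> relative to \<open>M\<close>; the set \<open>Y + e B\<close> is \<^term>\<open>cball Y e\<close>.
\<close>

definition closed_convex_regularization ::
    "('a::real_normed_vector \<Rightarrow> 'a) \<Rightarrow> 'a set \<Rightarrow> 'a \<Rightarrow> 'a set"
  where "closed_convex_regularization f M Y =
    (\<Inter>e\<in>{0<..}. closure (convex hull (f ` (cball Y e \<inter> M))))"

text \<open>
  Absolute continuity of functions, not to be confused with the library's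
  \<^const>\<open>absolutely_continuous\<close>, which is about measures. A pair \<open>(a, b)\<close> stands for the
  interval \<open>[a, b]\<close>, and \<open>I\<close> ranges over finite families of non-overlapping intervals.
\<close>

definition absolutely_continuous_on :: "real set \<Rightarrow> (real \<Rightarrow> 'a::metric_space) \<Rightarrow> bool"
  where "absolutely_continuous_on S g \<longleftrightarrow>
    (\<forall>e>0. \<exists>d>0. \<forall>I.
       finite I \<and> (\<forall>(a, b)\<in>I. a < b \<and> {a..b} \<subseteq> S) \<and>
       pairwise (\<lambda>(a, b) (a', b'). disjnt {a<..<b} {a'<..<b'}) I \<and>
       (\<Sum>(a, b)\<in>I. b - a) < d \<longrightarrow>
       (\<Sum>(a, b)\<in>I. dist (g a) (g b)) < e)"

definition solves_inclusion ::
    "('a::real_normed_vector \<Rightarrow> 'a set) \<Rightarrow> 'a set \<Rightarrow> 'a \<Rightarrow> real \<Rightarrow> (real \<Rightarrow> 'a) \<Rightarrow> bool"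
  where "solves_inclusion \<F> M Y\<^sub>0 T Y \<longleftrightarrow>
    absolutely_continuous_on {0..T} Y \<and> (\<forall>t\<in>{0..T}. Y t \<in> M) \<and> Y 0 = Y\<^sub>0 \<and>
    (AE t in lebesgue_on {0..T}.
       \<exists>D. (Y has_vector_derivative D) (at t within {0..T}) \<and> D \<in> \<F> (Y t))"

text \<open>Every matrix of rank \<open>r\<close> has a factorization as above.\<close>

lemma orthonormal_columns_subspace:
  fixes W :: "(real^'m) set"
  assumes "subspace W" "dim W = CARD('r)"
  obtains U :: "real^'r^'m" where "orthonormal_columns U"
    and "\<And>w. w \<in> W \<Longrightarrow> (U ** transpose U) *v w = w"
proof -
  obtain B where B: "B \<subseteq> W" "pairwise orthogonal B" "\<And>x. x \<in> B \<Longrightarrow> norm x = 1"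
    "independent B" "card B = dim W" "span B = W"
    using orthonormal_basis_subspace[OF assms(1)] by metis
  have "finite B" using B(4) by (rule independent_imp_finite)
  then obtain b :: "'r \<Rightarrow> real^'m" where b: "bij_betw b UNIV B"
    using B(5) assms(2) by (metis finite_class.finite_UNIV finite_same_card_bij)
  define U :: "real^'r^'m" where "U = (\<chi> i j. b j $ i)"
  have col: "column j U = b j" for j
    by (simp add: U_def column_def vec_eq_iff)
  have bb: "b i \<bullet> b j = (if i = j then 1 else 0)" for i j
  proof (cases "i = j")
    case True
    have "b j \<in> B" using b by (auto simp: bij_betw_def)
    then show ?thesis using True B(3) by (simp add: norm_eq_1)
  next
    case False
    then have "b i \<noteq> b j" "b i \<in> B" "b j \<in> B" using b by (auto simp: bij_betw_def inj_def)
    then show ?thesis using False B(2) by (auto simp: pairwise_def orthogonal_def)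
  qed
  have o: "transpose U ** U = mat 1"
    using bb by (simp add: vec_eq_iff matrix_matrix_mult_def transpose_def mat_def U_def inner_vec_def)
  have "columns U = B"
    using b by (auto simp: columns_def col bij_betw_def)
  have "(U ** transpose U) *v w = w" if "w \<in> W" for w
  proof -
    have "w \<in> span (columns U)" using that B(6) \<open>columns U = B\<close> by simp
    moreover have "span (columns U) \<subseteq> range ((*v) U)"
      by (intro span_minimal linear_subspace_image subspace_UNIV matrix_vector_mul_linear)
        (auto simp: columns_image_basis)
    ultimately obtain c where "w = U *v c" by auto
    then show ?thesis
      by (metis matrix_mul_assoc matrix_vector_mul_assoc matrix_mul_rid o)
  qed
  with o show thesis by (intro that) (auto simp: orthonormal_columns_def)
qed

lemma projection_mult_eq:
  fixes P :: "real^'m^'m" and Z :: "real^'n^'m"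
  assumes "\<And>w. w \<in> span (columns Z) \<Longrightarrow> P *v w = w"
  shows "P ** Z = Z"
  using assms matrix_vector_mult_in_columnspace[of Z]
  by (simp add: matrix_eq matrix_vector_mul_assoc[symmetric])

lemma low_rank_factorization_exists:
  fixes Y :: "real^'n^'m"
  assumes "Y \<in> fixed_rank CARD('r)"
  obtains U :: "real^'r^'m" and \<Sigma> :: "real^'r^'r" and V :: "real^'r^'n"
    where "low_rank_factorization Y U \<Sigma> V"
proof -
  have cols: "dim (span (columns Y)) = CARD('r)" "dim (span (columns (transpose Y))) = CARD('r)"
    using assms by (simp_all add: fixed_rank_def row_rank_def[symmetric] column_rank_def[symmetric])
  obtain U :: "real^'r^'m" where U: "orthonormal_columns U" "(U ** transpose U) ** Y = Y"
    using orthonormal_columns_subspace[OF subspace_span cols(1)] projection_mult_eq by metis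
  obtain V :: "real^'r^'n"
    where V: "orthonormal_columns V" "(V ** transpose V) ** transpose Y = transpose Y"
    using orthonormal_columns_subspace[OF subspace_span cols(2)] projection_mult_eq by metis
  have "transpose (V ** transpose V ** transpose Y) = Y" using V(2) by simp
  then have "Y ** (V ** transpose V) = Y"
    by (simp add: matrix_transpose_mul)
  with U(2) have "Y = U ** (transpose U ** Y ** V) ** transpose V"
    by (simp add: matrix_mul_assoc)
  with assms U(1) V(1) show thesis
    by (intro that[of U _ V]) (auto simp: low_rank_factorization_def)
qed

end

theory Submission
  imports Defs
begin

text \<open>
  The error of the DEIM projection factors as \<open>(I - P\<^sub>U) N (I - P\<^sub>V)\<close>, where \<open>N\<close> is the normal
  component of \<open>F(Y)\<close>; a nonzero idempotent and its complement satisfy the same norm bound, so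
  \<open>f\<close> differs from \<open>F\<close> on the manifold by at most \<open>K = C\<^sub>m\<^sub>r C\<^sub>n\<^sub>r \<epsilon>\<^sub>r\<close>. The one-sided Lipschitz
  inequality, perturbed by \<open>K\<close>, is for fixed \<open>A\<close> and \<open>Y\<close> a closed half-space condition on the
  velocity of \<open>Y\<close>, hence passes to the closed convex regularization. A Gronwall
  argument for the absolutely continuous function \<open>A - Y\<close> then gives the estimate.
\<close>

subsection \<open>The DEIM projection error\<close>

text \<open>The bound is tested at a second vector in the plane spanned by \<open>P x\<close> and
  \<open>x - P x\<close>: it has the norm of \<open>x\<close>, and its image under \<open>P\<close>
  is as long as \<open>x - P x\<close>. If one component vanishes there is no such plane, and
  \<open>1 \<le> C\<close> gives the estimate directly.\<close>

lemma norm_idempotent_complement_le: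
  fixes P :: "'a::real_inner \<Rightarrow> 'a"
  assumes lin: "linear P" and idem: "\<And>x. P (P x) = P x"
    and bound: "\<And>x. norm (P x) \<le> C * norm x" and "1 \<le> C"
  shows "norm (x - P x) \<le> C * norm x"
proof -
  define u v where "u = P x" and "v = x - P x"
  have Pu: "P u = u" and Pv: "P v = 0"
    using idem by (simp_all add: u_def v_def linear_diff[OF lin])
  consider "u = 0" | "v = 0" | "u \<noteq> 0" "v \<noteq> 0" by blast
  then show ?thesis
  proof cases
    case 1
    then show ?thesis
      using \<open>1 \<le> C\<close> mult_right_mono[of 1 C "norm x"] by (simp add: u_def)
  next
    case 2
    then show ?thesis
      using \<open>1 \<le> C\<close> by (simp add: v_def)
  next
    case 3
    \<comment> \<open>Exchanging the lengths of the two components of \<open>x\<close> preserves the norm of their sum.\<close>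
    define w where "w = (norm v / norm u) *\<^sub>R u + (norm u / norm v) *\<^sub>R v"
    have "P w = (norm v / norm u) *\<^sub>R u"
      by (simp add: w_def linear_add[OF lin] linear_scale[OF lin] Pu Pv)
    then have Pw: "norm (P w) = norm v" using 3 by simp
    have "w \<bullet> w = (norm v / norm u)\<^sup>2 * (u \<bullet> u) + (norm u / norm v)\<^sup>2 * (v \<bullet> v)
        + 2 * ((norm v / norm u) * (norm u / norm v)) * (u \<bullet> v)"
      by (simp add: w_def inner_add_left inner_add_right power2_eq_square inner_commute algebra_simps)
    also have "\<dots> = v \<bullet> v + u \<bullet> u + 2 * (u \<bullet> v)"
      using 3 by (simp add: power_divide power2_norm_eq_inner)
    also have "\<dots> = (u + v) \<bullet> (u + v)"
      by (simp add: inner_add_left inner_add_right inner_commute)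
    also have "u + v = x" by (simp add: u_def v_def)
    finally have "norm w = norm x" by (simp add: norm_eq_sqrt_inner)
    then show ?thesis using bound[of w] Pw by (simp add: v_def)
  qed
qed

section \<open>Frobenius norm estimates for products and selection matrices\<close>

lemma norm_transpose: "norm (transpose A) = norm (A :: real^'n^'m)"
  unfolding norm_matrix_eq_Frobenius
  by (subst sum.swap) (simp add: transpose_def)

lemma norm_matrix_eq_columns:
  fixes A :: "real^'n^'m"
  shows "(norm A)\<^sup>2 = (\<Sum>j\<in>UNIV. (norm (column j A))\<^sup>2)"
  by (subst norm_transpose[symmetric])
    (simp add: power2_norm_eq_inner inner_vec_def transpose_def column_def)

lemma column_matrix_mult: "column j (A ** B) = A *v column j B"
  by (simp add: vec_eq_iff column_def matrix_matrix_mult_def matrix_vector_mult_def)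

text \<open>The bound holds column by column, and the squares add up. An operator bound thus carries
  over to the Frobenius norm without a dimension factor.\<close>

lemma norm_matrix_mult_le:
  fixes A :: "real^'n^'m" and Z :: "real^'k^'n"
  assumes bound: "\<And>x. norm (A *v x) \<le> C * norm x" and "0 \<le> C"
  shows "norm (A ** Z) \<le> C * norm Z"
proof (rule power2_le_imp_le)
  have "(norm (A ** Z))\<^sup>2 \<le> (\<Sum>j\<in>UNIV. (C * norm (column j Z))\<^sup>2)"
    unfolding norm_matrix_eq_columns column_matrix_mult
    by (intro sum_mono power_mono bound) auto
  also have "\<dots> = (C * norm Z)\<^sup>2"
    by (simp add: power_mult_distrib norm_matrix_eq_columns sum_distrib_left)
  finally show "(norm (A ** Z))\<^sup>2 \<le> (C * norm Z)\<^sup>2" .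
qed (use \<open>0 \<le> C\<close> in simp)

lemma norm_orthonormal_columns_mult:
  fixes U :: "real^'r^'m"
  assumes "orthonormal_columns U"
  shows "norm (U *v x) = norm x"
proof -
  have "(U *v x) \<bullet> (U *v x) = x \<bullet> (transpose U *v (U *v x))"
    by (metis dot_lmul_matrix inner_commute vector_transpose_matrix transpose_transpose)
  also have "\<dots> = x \<bullet> x"
    using assms by (simp add: matrix_vector_mul_assoc orthonormal_columns_def)
  finally show ?thesis by (simp add: norm_eq_sqrt_inner)
qed

lemma power2_norm_vec: "(norm x)\<^sup>2 = (\<Sum>i\<in>UNIV. (x $ i)\<^sup>2)" for x :: "real^'n"
  unfolding power2_norm_eq_inner by (simp add: inner_vec_def power2_eq_square)

text \<open>The transpose reads off the entries of \<open>x\<close> at the indices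
  \<open>p j\<close>. As \<open>p\<close> is injective no entry is counted twice, so the squared
  norm is a partial sum of that of \<open>x\<close>.\<close>

lemma norm_transpose_selection_matrix_mult_le:
  fixes S :: "real^'r^'m"
  assumes "selection_matrix S"
  shows "norm (transpose S *v x) \<le> norm x"
proof -
  obtain p where p: "inj p" "\<And>j. column j S = axis (p j) 1"
    using assms by (auto simp: selection_matrix_def)
  have "(transpose S *v x) $ j = x $ p j" for j
    using p(2)[of j] by (simp add: matrix_vector_mul_component column_def transpose_def inner_axis')
  then have "(norm (transpose S *v x))\<^sup>2 = (\<Sum>j\<in>UNIV. (x $ p j)\<^sup>2)"
    by (simp add: power2_norm_vec del: transpose_matrix_vector)
  also have "\<dots> = (\<Sum>i\<in>range p. (x $ i)\<^sup>2)"
    using p(1) by (simp add: sum.reindex)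
  also have "\<dots> \<le> (\<Sum>i\<in>UNIV. (x $ i)\<^sup>2)"
    by (rule sum_mono2) auto
  also have "\<dots> = (norm x)\<^sup>2"
    by (simp add: power2_norm_vec)
  finally show ?thesis by (rule power2_le_imp_le) simp
qed

section \<open>Matrix algebra and inverses\<close>

lemma matrix_diff_rdistrib: "(A - B) ** C = A ** C - B ** (C :: 'a::ring_1^'k^'n)"
  by (simp add: vec_eq_iff matrix_matrix_mult_def left_diff_distrib sum_subtractf)

lemma matrix_add_rdistrib: "(A + B) ** C = A ** C + B ** (C :: 'a::semiring_1^'k^'n)"
  by (simp add: vec_eq_iff matrix_matrix_mult_def distrib_right sum.distrib)

lemma matrix_diff_ldistrib: "A ** (B - C) = A ** B - A ** (C :: 'a::ring_1^'k^'n)"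
  by (simp add: vec_eq_iff matrix_matrix_mult_def right_diff_distrib sum_subtractf)

lemma transpose_diff: "transpose (A - B) = transpose A - transpose B"
  by (simp add: vec_eq_iff transpose_def)

lemma matrix_inv_inverse:
  fixes A :: "real^'n^'n"
  assumes "invertible A"
  shows "A ** matrix_inv A = mat 1" "matrix_inv A ** A = mat 1"
  using someI_ex[OF assms[unfolded invertible_def]] by (simp_all add: matrix_inv_def)

lemma transpose_matrix_inv:
  fixes A :: "real^'n^'n"
  assumes "invertible A"
  shows "transpose (matrix_inv A) = matrix_inv (transpose A)"
proof -
  have "transpose A ** transpose (matrix_inv A) = mat 1"
    "transpose (matrix_inv A) ** transpose A = mat 1"
    using matrix_inv_inverse[OF assms] by (simp_all flip: matrix_transpose_mul)
  then show ?thesis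
    using matrix_inv_inverse(2)[OF transpose_invertible[OF assms]]
    by (metis matrix_mul_assoc matrix_mul_lid matrix_mul_rid)
qed

section \<open>The oblique projection of a single DEIM procedure\<close>

context
  fixes S :: "real^'r^'m \<Rightarrow> real^'r^'m" and C :: real and U :: "real^'r^'m"
  assumes deim: "deim_procedure S C" and orth: "orthonormal_columns U"
begin

lemma deim_invertible: "invertible (transpose (S U) ** U)"
  using deim orth by (simp add: deim_procedure_def)

lemma deim_left_mult: "deim_left S U ** U = U"
  using matrix_inv_inverse(2)[OF deim_invertible]
  by (simp add: deim_left_def flip: matrix_mul_assoc)

lemma deim_left_idem: "deim_left S U ** deim_left S U = deim_left S U"
  using deim_left_mult by (metis deim_left_def matrix_mul_assoc)

text \<open>Transposition exchanges the two oblique projections of one procedure, so every row space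
  estimate reduces to the column space estimate.\<close>

lemma transpose_deim_right: "transpose (deim_right S U) = deim_left S U"
proof -
  have "invertible (transpose U ** S U)"
    using deim_invertible by (metis transpose_invertible matrix_transpose_mul transpose_transpose)
  then show ?thesis
    by (simp add: deim_right_def deim_left_def matrix_transpose_mul matrix_mul_assoc
        transpose_matrix_inv)
qed

text \<open>\<open>U\<close> acts as an isometry and the transposed selection matrix as a
  contraction, so only the inverse in the middle contributes to the constant.\<close>

lemma norm_deim_left_le: "norm (deim_left S U *v x) \<le> C * norm x"
proof -
  let ?R = "matrix_inv (transpose (S U) ** U)"
  have sel: "selection_matrix (S U)" and C: "spectral_norm ?R \<le> C"
    using deim orth by (auto simp: deim_procedure_def)
  have "norm (deim_left S U *v x) = norm (?R *v (transpose (S U) *v x))"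
    using norm_orthonormal_columns_mult[OF orth]
    by (simp add: deim_left_def flip: matrix_vector_mul_assoc)
  also have "\<dots> \<le> spectral_norm ?R * norm (transpose (S U) *v x)"
    unfolding spectral_norm_def by (rule onorm) simp
  also have "\<dots> \<le> C * norm x"
    using C norm_transpose_selection_matrix_mult_le[OF sel, of x]
    by (intro mult_mono) (auto intro: order_trans[OF onorm_pos_le] simp: spectral_norm_def)
  finally show ?thesis .
qed

text \<open>The projection fixes a unit vector in the range of \<open>U\<close>, which forces its
  bound to be at least one. Index types are nonempty, so \<open>axis undefined 1\<close> is some
  standard unit vector.\<close>

lemma deim_constant_ge_1: "1 \<le> C"
proof -
  define y where "y = U *v axis undefined 1"
  have "norm y = 1" by (simp add: y_def norm_orthonormal_columns_mult[OF orth])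
  moreover have "deim_left S U *v y = y"
    by (simp add: y_def matrix_vector_mul_assoc deim_left_mult)
  ultimately show ?thesis using norm_deim_left_le[of y] by simp
qed

lemma norm_deim_complement_mult_le: "norm (Z - deim_left S U ** Z) \<le> C * norm Z"
proof -
  have "norm ((mat 1 - deim_left S U) *v x) \<le> C * norm x" for x
    using norm_idempotent_complement_le[of "(*v) (deim_left S U)" C x]
    by (simp add: matrix_vector_mul_assoc deim_left_idem norm_deim_left_le deim_constant_ge_1
        matrix_vector_mult_diff_rdistrib)
  from norm_matrix_mult_le[OF this] show ?thesis
    using deim_constant_ge_1 by (simp add: matrix_diff_rdistrib)
qed

end

text \<open>
  Since \<open>deim_left\<close> fixes the columns of \<open>U\<close> and \<open>deim_right\<close> the rows of \<open>V\<^sup>T\<close>, the DEIM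
  projection error only sees the normal component of \<open>Z\<close>.
\<close>

lemma norm_deim_projection_error_le:
  fixes U :: "real^'r^'m" and V :: "real^'r^'n" and Z :: "real^'n^'m"
  assumes S: "deim_procedure S\<^sub>U C\<^sub>U" "deim_procedure S\<^sub>V C\<^sub>V"
    and orth: "orthonormal_columns U" "orthonormal_columns V"
  shows "norm (Z - deim_projection S\<^sub>U S\<^sub>V U V Z)
    \<le> C\<^sub>U * C\<^sub>V * norm (tangent_projection U V Z - Z)"
proof -
  let ?L = "deim_left S\<^sub>U U" and ?R = "deim_right S\<^sub>V V"
  define N where "N = Z - tangent_projection U V Z"
  have LU: "?L ** U = U" using deim_left_mult[OF S(1) orth(1)] .
  have VR: "transpose V ** ?R = transpose V"
    using deim_left_mult[OF S(2) orth(2)] transpose_deim_right[OF S(2) orth(2)]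
    by (metis matrix_transpose_mul transpose_transpose)
  have LU': "?L ** (U ** X) = U ** X" for X :: "real^'n^'r"
    by (simp add: matrix_mul_assoc LU)
  \<comment> \<open>With L and R for the two oblique projections, the left side is (I - L) Z (I -
    R). Passing from \<open>Z\<close> to \<open>N\<close> changes nothing: I - L annihilates the
    terms beginning with \<open>U\<close>, and I - R those ending with the transpose of
    \<open>V\<close>.\<close>
  have error: "Z - deim_projection S\<^sub>U S\<^sub>V U V Z = (N - ?L ** N) - (N - ?L ** N) ** ?R"
    unfolding N_def tangent_projection_def deim_projection_def
    by (simp add: matrix_diff_ldistrib matrix_diff_rdistrib matrix_add_ldistrib matrix_add_rdistrib
        LU' VR flip: matrix_mul_assoc)
  define M where "M = N - ?L ** N"
  \<comment> \<open>Multiplication by I - R from the right becomes, after transposing, the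
    complement estimate for \<open>V\<close>.\<close>
  have "transpose (M - M ** ?R) = transpose M - deim_left S\<^sub>V V ** transpose M"
    by (simp add: transpose_diff matrix_transpose_mul transpose_deim_right[OF S(2) orth(2)])
  then have "norm (M - M ** ?R) \<le> C\<^sub>V * norm (transpose M)"
    using norm_deim_complement_mult_le[OF S(2) orth(2), of "transpose M"] by (metis norm_transpose)
  also have "\<dots> \<le> C\<^sub>V * (C\<^sub>U * norm N)"
    using norm_deim_complement_mult_le[OF S(1) orth(1), of N]
      deim_constant_ge_1[OF S(2) orth(2)] by (simp add: norm_transpose M_def)
  finally show ?thesis
    by (simp add: error M_def N_def norm_minus_commute mult_ac)
qed

subsection \<open>Absolutely continuous functions\<close>

lemma absolutely_continuous_onE:
  assumes "absolutely_continuous_on S g" "e > 0"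
  obtains d where "d > 0"
    and "\<And>I. finite I \<Longrightarrow> (\<And>a b. (a, b) \<in> I \<Longrightarrow> a < b \<and> {a..b} \<subseteq> S) \<Longrightarrow>
      pairwise (\<lambda>(a, b) (a', b'). disjnt {a<..<b} {a'<..<b'}) I \<Longrightarrow>
      (\<Sum>(a, b)\<in>I. b - a) < d \<Longrightarrow> (\<Sum>(a, b)\<in>I. dist (g a) (g b)) < e"
proof -
  obtain d where "d > 0" and d: "\<forall>I. finite I \<and> (\<forall>(a, b)\<in>I. a < b \<and> {a..b} \<subseteq> S) \<and>
       pairwise (\<lambda>(a, b) (a', b'). disjnt {a<..<b} {a'<..<b'}) I \<and>
       (\<Sum>(a, b)\<in>I. b - a) < d \<longrightarrow> (\<Sum>(a, b)\<in>I. dist (g a) (g b)) < e"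
    using assms(1)[unfolded absolutely_continuous_on_def, rule_format, OF assms(2)]
    by (elim exE conjE) (rule that)
  show thesis
    by (rule that[OF \<open>d > 0\<close>], rule d[rule_format]) auto
qed

lemma absolutely_continuous_onI:
  assumes "\<And>e. e > 0 \<Longrightarrow> \<exists>d>0. \<forall>I. finite I \<longrightarrow> (\<forall>a b. (a, b) \<in> I \<longrightarrow> a < b \<and> {a..b} \<subseteq> S) \<longrightarrow>
      pairwise (\<lambda>(a, b) (a', b'). disjnt {a<..<b} {a'<..<b'}) I \<longrightarrow>
      (\<Sum>(a, b)\<in>I. b - a) < d \<longrightarrow> (\<Sum>(a, b)\<in>I. dist (g a) (g b)) < e"
  shows "absolutely_continuous_on S g"
  unfolding absolutely_continuous_on_def
proof (intro allI impI)
  fix e :: real assume "e > 0"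
  from assms[OF this] show "\<exists>d>0. \<forall>I. finite I \<and> (\<forall>(a, b)\<in>I. a < b \<and> {a..b} \<subseteq> S) \<and>
       pairwise (\<lambda>(a, b) (a', b'). disjnt {a<..<b} {a'<..<b'}) I \<and>
       (\<Sum>(a, b)\<in>I. b - a) < d \<longrightarrow> (\<Sum>(a, b)\<in>I. dist (g a) (g b)) < e"
    by (elim exE conjE, intro exI conjI allI impI) (auto simp: Ball_def)
qed

lemma absolutely_continuous_on_subset:
  assumes "absolutely_continuous_on S g" "T \<subseteq> S"
  shows "absolutely_continuous_on T g"
proof (rule absolutely_continuous_onI)
  fix e :: real assume "e > 0"
  from absolutely_continuous_onE[OF assms(1) this] obtain d where "d > 0"
    and d: "\<And>I. finite I \<Longrightarrow> (\<And>a b. (a, b) \<in> I \<Longrightarrow> a < b \<and> {a..b} \<subseteq> S) \<Longrightarrow>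
      pairwise (\<lambda>(a, b) (a', b'). disjnt {a<..<b} {a'<..<b'}) I \<Longrightarrow>
      (\<Sum>(a, b)\<in>I. b - a) < d \<Longrightarrow> (\<Sum>(a, b)\<in>I. dist (g a) (g b)) < e"
    by metis
  show "\<exists>d>0. \<forall>I. finite I \<longrightarrow> (\<forall>a b. (a, b) \<in> I \<longrightarrow> a < b \<and> {a..b} \<subseteq> T) \<longrightarrow>
      pairwise (\<lambda>(a, b) (a', b'). disjnt {a<..<b} {a'<..<b'}) I \<longrightarrow>
      (\<Sum>(a, b)\<in>I. b - a) < d \<longrightarrow> (\<Sum>(a, b)\<in>I. dist (g a) (g b)) < e"
    using \<open>T \<subseteq> S\<close> by (intro exI[of _ d] conjI \<open>d > 0\<close> allI impI d) (blast intro: subset_trans)+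
qed

text \<open>Summing over a family bounds the variation of \<open>h\<close> by a multiple of the
  variation of \<open>g\<close> plus the total length. The length term makes room for Lipschitz
  summands and Lipschitz factors.\<close>

lemma absolutely_continuous_on_dominated:
  fixes g :: "real \<Rightarrow> 'a::metric_space" and h :: "real \<Rightarrow> 'b::metric_space"
  assumes ac: "absolutely_continuous_on S g"
    and le: "\<And>u v. u \<in> S \<Longrightarrow> v \<in> S \<Longrightarrow> dist (h u) (h v) \<le> M * (dist (g u) (g v) + dist u v)"
  shows "absolutely_continuous_on S h"
proof (rule absolutely_continuous_onI)
  fix e :: real assume "e > 0"
  define m where "m = max M 1"
  have m: "m \<ge> 1" "m \<ge> M" by (auto simp: m_def)
  define e' where "e' = e / (2 * m)"
  have "e' > 0" using \<open>e > 0\<close> m by (simp add: e'_def)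
  obtain d where "d > 0"
    and d: "\<And>I. finite I \<Longrightarrow> (\<And>u v. (u, v) \<in> I \<Longrightarrow> u < v \<and> {u..v} \<subseteq> S) \<Longrightarrow>
      pairwise (\<lambda>(u, v) (u', v'). disjnt {u<..<v} {u'<..<v'}) I \<Longrightarrow>
      (\<Sum>(u, v)\<in>I. v - u) < d \<Longrightarrow> (\<Sum>(u, v)\<in>I. dist (g u) (g v)) < e'"
    using absolutely_continuous_onE[OF ac \<open>e' > 0\<close>] by metis
  show "\<exists>d>0. \<forall>I. finite I \<longrightarrow> (\<forall>a b. (a, b) \<in> I \<longrightarrow> a < b \<and> {a..b} \<subseteq> S) \<longrightarrow>
       pairwise (\<lambda>(a, b) (a', b'). disjnt {a<..<b} {a'<..<b'}) I \<longrightarrow>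
       (\<Sum>(a, b)\<in>I. b - a) < d \<longrightarrow> (\<Sum>(a, b)\<in>I. dist (h a) (h b)) < e"
  \<comment> \<open>Total length below \<open>d\<close> controls the variation of \<open>g\<close>;
    below \<open>e'\<close> it controls the length term itself.\<close>
  proof (intro exI[of _ "min d e'"] conjI allI impI)
    fix I
    assume I: "finite I" "\<forall>a b. (a, b) \<in> I \<longrightarrow> a < b \<and> {a..b} \<subseteq> S"
       "pairwise (\<lambda>(a, b) (a', b'). disjnt {a<..<b} {a'<..<b'}) I"
       "(\<Sum>(a, b)\<in>I. b - a) < min d e'"
    have "(\<Sum>(a, b)\<in>I. dist (h a) (h b)) \<le> (\<Sum>(a, b)\<in>I. m * (dist (g a) (g b) + (b - a)))"
    proof (rule sum_mono, clarify)
      fix a b assume "(a, b) \<in> I"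
      with I(2) have ab: "a < b" "{a..b} \<subseteq> S" by auto
      then have "a \<in> S" "b \<in> S" by auto
      from le[OF this] have "dist (h a) (h b) \<le> M * (dist (g a) (g b) + (b - a))"
        using ab by (simp add: dist_real_def)
      also have "\<dots> \<le> m * (dist (g a) (g b) + (b - a))"
        using ab m by (intro mult_right_mono) auto
      finally show "dist (h a) (h b) \<le> m * (dist (g a) (g b) + (b - a))" .
    qed
    also have "\<dots> = m * ((\<Sum>(a, b)\<in>I. dist (g a) (g b)) + (\<Sum>(a, b)\<in>I. b - a))"
      by (simp add: sum_distrib_left sum.distrib[symmetric] case_prod_unfold)
    also have "\<dots> < m * (e' + e')"
      using d[of I] I m by (intro mult_strict_left_mono add_strict_mono) simp_all
    also have "\<dots> = e" using m by (simp add: e'_def)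
    finally show "(\<Sum>(a, b)\<in>I. dist (h a) (h b)) < e" .
  qed (use \<open>d > 0\<close> \<open>e' > 0\<close> in auto)
qed

lemma absolutely_continuous_on_imp_continuous_on:
  assumes "absolutely_continuous_on {a..b} g"
  shows "continuous_on {a..b} g"
  unfolding continuous_on_iff
proof (intro ballI allI impI)
  fix x and e :: real assume x: "x \<in> {a..b}" and "e > 0"
  obtain d where "d > 0"
    and d: "\<And>I. finite I \<Longrightarrow> (\<And>u v. (u, v) \<in> I \<Longrightarrow> u < v \<and> {u..v} \<subseteq> {a..b}) \<Longrightarrow>
      pairwise (\<lambda>(u, v) (u', v'). disjnt {u<..<v} {u'<..<v'}) I \<Longrightarrow>
      (\<Sum>(u, v)\<in>I. v - u) < d \<Longrightarrow> (\<Sum>(u, v)\<in>I. dist (g u) (g v)) < e"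
    using absolutely_continuous_onE[OF assms \<open>e > 0\<close>] by metis
  have *: "dist (g u) (g v) < e" if "u \<in> {a..b}" "v \<in> {a..b}" "u < v" "v - u < d" for u v
    using d[of "{(u, v)}"] that by simp
  show "\<exists>d>0. \<forall>y\<in>{a..b}. dist y x < d \<longrightarrow> dist (g y) (g x) < e"
  proof (intro exI[of _ d] conjI ballI impI \<open>d > 0\<close>)
    fix y assume y: "y \<in> {a..b}" "dist y x < d"
    show "dist (g y) (g x) < e"
      using *[OF x y(1)] *[OF y(1) x] y(2) \<open>e > 0\<close>
      by (cases y x rule: linorder_cases) (auto simp: dist_real_def dist_commute)
  qed
qed

text \<open>Cells may share end points, but their interiors are disjoint, lie in \<open>G\<close>
  and have the same lengths, so their measures add up to at most that of \<open>G\<close>.\<close>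

lemma tagged_partial_division_length_le:
  fixes p :: "(real \<times> real set) set"
  assumes p: "p tagged_partial_division_of {a..b}"
    and sub: "\<And>x K. (x, K) \<in> p \<Longrightarrow> Inf K < Sup K \<and> K \<subseteq> G" and "G \<in> lmeasurable"
  shows "(\<Sum>(x, K)\<in>p. Sup K - Inf K) \<le> measure lebesgue G"
proof -
  have K: "K = {Inf K..Sup K}" "Inf K < Sup K" "interior K = {Inf K<..<Sup K}" if xK: "(x, K) \<in> p" for x K
  proof -
    obtain u v where "K = {u..v}" "x \<in> K"
      using tagged_partial_division_ofD(2,4)[OF p xK] by auto
    then show "K = {Inf K..Sup K}" "Inf K < Sup K" "interior K = {Inf K<..<Sup K}"
      using sub[OF xK] by auto
  qed
  have fin: "finite p" using p by (rule tagged_partial_division_ofD)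
  have "(\<Sum>(x, K)\<in>p. Sup K - Inf K) = (\<Sum>q\<in>p. measure lebesgue (interior (snd q)))"
    using K by (intro sum.cong refl) (auto simp: less_imp_le)
  also have "\<dots> = measure lebesgue (\<Union>q\<in>p. interior (snd q))"
  proof (rule measure_finite_Union[symmetric, OF fin])
    show "disjoint_family_on (\<lambda>q. interior (snd q)) p"
      using tagged_partial_division_ofD(5)[OF p] unfolding disjoint_family_on_def by (metis prod.collapse)
    show "(\<lambda>q. interior (snd q)) ` p \<subseteq> sets lebesgue" by auto
    show "emeasure lebesgue (interior (snd q)) \<noteq> \<infinity>" if "q \<in> p" for q
      using K[of "fst q" "snd q"] that by (simp add: less_imp_le)
  qed
  also have "\<dots> \<le> measure lebesgue G"
  proof (rule measure_mono_fmeasurable)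
    show "(\<Union>q\<in>p. interior (snd q)) \<subseteq> G"
      using sub interior_subset by fastforce
  qed (use \<open>G \<in> lmeasurable\<close> in \<open>auto intro!: borel_open sets_completionI_sets open_UN\<close>)
  finally show ?thesis .
qed

text \<open>
  Cousin's lemma replaces the Vitali covering argument: tags in the exceptional set get intervals
  inside an open set of small measure, where absolute continuity controls the total variation.
\<close>

lemma absolutely_continuous_on_nonincreasing:
  fixes g :: "real \<Rightarrow> real"
  assumes ac: "absolutely_continuous_on {a..b} g" and "a \<le> b" and N: "negligible N"
    and der: "\<And>t. t \<in> {a..b} - N \<Longrightarrow> \<exists>D\<le>0. (g has_vector_derivative D) (at t within {a..b})"
  shows "g b \<le> g a"
proof -
  have *: "g b - g a \<le> e * (b - a) + e" if "e > 0" for e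
  proof -
    obtain d where "d > 0"
    and d: "\<And>I. finite I \<Longrightarrow> (\<And>u v. (u, v) \<in> I \<Longrightarrow> u < v \<and> {u..v} \<subseteq> {a..b}) \<Longrightarrow>
      pairwise (\<lambda>(u, v) (u', v'). disjnt {u<..<v} {u'<..<v'}) I \<Longrightarrow>
      (\<Sum>(u, v)\<in>I. v - u) < d \<Longrightarrow> (\<Sum>(u, v)\<in>I. dist (g u) (g v)) < e"
    using absolutely_continuous_onE[OF ac \<open>e > 0\<close>] by metis
    have "N \<in> sets lebesgue" using N by (simp add: negligible_imp_sets)
    \<comment> \<open>Since \<open>N\<close> is null, smallness of \<open>G - N\<close> makes all of
      \<open>G\<close> small. The threshold \<open>d\<close> is the one from absolute
      continuity.\<close>
    then obtain G where G: "open G" "N \<subseteq> G" "G - N \<in> lmeasurable" "emeasure lebesgue (G - N) < ennreal d"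
      using sets_lebesgue_outer_open \<open>d > 0\<close> by blast
    have "G \<in> lmeasurable" and "measure lebesgue G < d"
    proof -
      have eq: "G = (G - N) \<union> N" using G(2) by auto
      show "G \<in> lmeasurable"
        using fmeasurable.Un[OF G(3) negligible_imp_measurable[OF N]] eq by simp
      have "measure lebesgue G = measure lebesgue (G - N)"
        using N \<open>G \<in> lmeasurable\<close> by (simp add: measure_Diff_null_set negligible_iff_null_sets fmeasurableD)
      also have "\<dots> < d"
        using G(3,4) \<open>d > 0\<close> by (simp add: emeasure_eq_measure2 ennreal_less_iff)
      finally show "measure lebesgue G < d" .
    qed
    \<comment> \<open>This is the gauge. Around a point of \<open>N\<close> the ball stays in
      \<open>G\<close>. Around a point with a derivative, comparing \<open>u\<close> and
      \<open>v\<close> with the tag between them gives a straddle inequality with slope at most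
      \<open>e\<close>. Any radius will do elsewhere.\<close>
    have "\<exists>r>0. (x \<in> N \<longrightarrow> ball x r \<subseteq> G) \<and>
        (x \<in> {a..b} - N \<longrightarrow> (\<forall>u\<in>{a..b} \<inter> ball x r. \<forall>v\<in>{a..b} \<inter> ball x r.
           u \<le> x \<and> x \<le> v \<longrightarrow> g v - g u \<le> e * (v - u)))" for x
    proof (cases "x \<in> {a..b} - N")
      case True
      then obtain D where "D \<le> 0" and D: "(g has_vector_derivative D) (at x within {a..b})"
        using der by blast
      from D \<open>e > 0\<close> obtain r where "r > 0"
        and r: "\<And>y. y \<in> {a..b} \<Longrightarrow> norm (y - x) < r \<Longrightarrow> norm (g y - g x - (y - x) *\<^sub>R D) \<le> e * norm (y - x)"
        unfolding has_vector_derivative_def has_derivative_within_alt by blast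
      have "g v - g u \<le> e * (v - u)" if "u \<in> {a..b} \<inter> ball x r" "v \<in> {a..b} \<inter> ball x r"
        "u \<le> x" "x \<le> v" for u v
      proof -
        have "\<bar>g u - g x - (u - x) * D\<bar> \<le> e * \<bar>u - x\<bar>" "\<bar>g v - g x - (v - x) * D\<bar> \<le> e * \<bar>v - x\<bar>"
          using r[of u] r[of v] that by (auto simp: dist_real_def abs_minus_commute)
        then have "g x - g u \<le> e * (x - u) + (x - u) * D" "g v - g x \<le> e * (v - x) + (v - x) * D"
          using that by (auto simp: abs_le_iff algebra_simps)
        moreover have "(x - u) * D \<le> 0" "(v - x) * D \<le> 0"
          using that \<open>D \<le> 0\<close> by (auto intro: mult_nonneg_nonpos)
        ultimately show ?thesis by (simp add: algebra_simps)
      qed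
      then show ?thesis using True \<open>r > 0\<close> by blast
    next
      case False
      show ?thesis
      proof (cases "x \<in> N")
        case True
        then show ?thesis using G(1,2) by (metis DiffD2 openE subsetD)
      qed (use False in \<open>auto intro: zero_less_one\<close>)
    qed
    then obtain r where r0: "\<And>x. r x > 0" and rN: "\<And>x. x \<in> N \<Longrightarrow> ball x (r x) \<subseteq> G"
      and rg: "\<And>x u v. x \<in> {a..b} - N \<Longrightarrow> u \<in> {a..b} \<inter> ball x (r x) \<Longrightarrow> v \<in> {a..b} \<inter> ball x (r x) \<Longrightarrow>
         u \<le> x \<Longrightarrow> x \<le> v \<Longrightarrow> g v - g u \<le> e * (v - u)"
      by metis
    have "gauge (\<lambda>x. ball x (r x))" using r0 by (auto simp: gauge_def)
    then obtain p where p: "p tagged_division_of {a..b}" and fine: "(\<lambda>x. ball x (r x)) fine p"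
      using fine_division_exists_real by blast
    have fin: "finite p" using p by blast
    have K: "K = {Inf K..Sup K}" "Inf K \<le> x" "x \<le> Sup K" "K \<subseteq> {a..b}" "K \<subseteq> ball x (r x)"
        "Inf K \<in> K" "Sup K \<in> K" "x \<in> {a..b}"
        "interior K = {Inf K<..<Sup K}"
      if xK: "(x, K) \<in> p" for x K
    proof -
      obtain u v where uv: "K = {u..v}" using tagged_division_ofD(4)[OF p xK] by auto
      have "x \<in> K" "K \<subseteq> {a..b}" using tagged_division_ofD(2,3)[OF p that] .
      moreover have "K \<subseteq> ball x (r x)" using fine that by (auto simp: fine_def)
      ultimately show "K = {Inf K..Sup K}" "Inf K \<le> x" "x \<le> Sup K" "K \<subseteq> {a..b}" "K \<subseteq> ball x (r x)"
        "Inf K \<in> K" "Sup K \<in> K" "x \<in> {a..b}"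
        "interior K = {Inf K<..<Sup K}"
        using uv by auto
    qed
    define q where "q = {(x, K) \<in> p. x \<in> N}"
    \<comment> \<open>Degenerate cells are removed, because absolute continuity speaks of intervals
      with \<open>a < b\<close>. They contribute nothing to the sum.\<close>
    define q' where "q' = {(x, K) \<in> q. Inf K < Sup K}"
    have q: "q \<subseteq> p" "q' \<subseteq> q" by (auto simp: q_def q'_def)
    have good: "(\<Sum>(x, K)\<in>p - q. g (Sup K) - g (Inf K)) \<le> e * (b - a)"
    proof -
      have "(\<Sum>(x, K)\<in>p - q. g (Sup K) - g (Inf K)) \<le> (\<Sum>(x, K)\<in>p - q. e * (Sup K - Inf K))"
      proof (rule sum_mono, clarify)
        fix x K assume "(x, K) \<in> p" "(x, K) \<notin> q"
        then show "g (Sup K) - g (Inf K) \<le> e * (Sup K - Inf K)"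
          using K[of x K] by (intro rg[of x]) (auto simp: q_def)
      qed
      also have "\<dots> \<le> (\<Sum>(x, K)\<in>p. e * (Sup K - Inf K))"
        using fin \<open>e > 0\<close> order_trans[OF K(2,3)] by (intro sum_mono2) auto
      also have "\<dots> = e * (b - a)"
        using additive_tagged_division_1[OF \<open>a \<le> b\<close> p, of "\<lambda>x. x"]
        by (simp add: case_prod_unfold flip: sum_distrib_left)
      finally show ?thesis .
    qed
    have bad: "(\<Sum>(x, K)\<in>q. g (Sup K) - g (Inf K)) < e"
    proof -
      let ?i = "\<lambda>(x::real, K::real set). (Inf K, Sup K)"
      have disj: "disjnt {Inf K<..<Sup K} {Inf K'<..<Sup K'}"
        if "(x, K) \<in> q'" "(x', K') \<in> q'" "(x, K) \<noteq> (x', K')" for x K x' K'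
        using tagged_division_ofD(5)[OF p, of x K x' K'] that q K(9)[of x K] K(9)[of x' K']
        by (simp add: disjnt_def subset_iff)
      \<comment> \<open>Absolute continuity is about a set of end point pairs. Two nondegenerate
        cells with equal end points have overlapping interiors, hence coincide together with their
        tags, so no increment is lost.\<close>
      have inj: "inj_on ?i q'"
      proof (rule inj_onI, clarify)
        fix x K x' K' assume *: "(x, K) \<in> q'" "(x', K') \<in> q'" "Inf K = Inf K'" "Sup K = Sup K'"
        then have "\<not> disjnt {Inf K<..<Sup K} {Inf K'<..<Sup K'}"
          by (auto simp: q'_def disjnt_def)
        then show "x = x' \<and> K = K'" using disj[OF *(1,2)] by auto
      qed
      have "q' tagged_partial_division_of {a..b}"
        using tagged_partial_division_subset[of p "{a..b}" q'] p q by (auto simp: tagged_division_of_def)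
      moreover have "Inf K < Sup K \<and> K \<subseteq> G" if "(x, K) \<in> q'" for x K
        using that K[of x K] rN[of x] by (auto simp: q'_def q_def)
      ultimately have len: "(\<Sum>(x, K)\<in>q'. Sup K - Inf K) < d"
        using tagged_partial_division_length_le[of q' a b G] \<open>G \<in> lmeasurable\<close> \<open>measure lebesgue G < d\<close>
        by fastforce
      have "(\<Sum>(u, v)\<in>?i ` q'. dist (g u) (g v)) < e"
      proof (rule d)
        show "finite (?i ` q')" using fin q by (meson finite_imageI finite_subset)
        show "u < v \<and> {u..v} \<subseteq> {a..b}" if "(u, v) \<in> ?i ` q'" for u v
        proof -
          from that obtain x K where xK: "(x, K) \<in> q'" "u = Inf K" "v = Sup K" by auto
          with q have "(x, K) \<in> p" by auto
          from K(1,4)[OF this] xK show ?thesis by (simp add: q'_def)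
        qed
        show "pairwise (\<lambda>(u, v) (u', v'). disjnt {u<..<v} {u'<..<v'}) (?i ` q')"
          using disj unfolding pairwise_image by (auto simp: pairwise_def)
        show "(\<Sum>(u, v)\<in>?i ` q'. v - u) < d"
          using len inj by (simp add: sum.reindex case_prod_unfold)
      qed
      then have "(\<Sum>(x, K)\<in>q'. dist (g (Inf K)) (g (Sup K))) < e"
        using inj by (simp add: sum.reindex case_prod_unfold)
      moreover have "(\<Sum>(x, K)\<in>q. g (Sup K) - g (Inf K)) = (\<Sum>(x, K)\<in>q'. g (Sup K) - g (Inf K))"
      proof (rule sum.mono_neutral_right)
        show "finite q" using fin q by (meson finite_subset)
        show "\<forall>i\<in>q - q'. (case i of (x, K) \<Rightarrow> g (Sup K) - g (Inf K)) = 0"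
        proof clarify
          fix x K assume xK: "(x, K) \<in> q" "(x, K) \<notin> q'"
          then have "(x, K) \<in> p" using q by blast
          from K(2,3)[OF this] xK have "Inf K = Sup K" by (simp add: q'_def)
          then show "g (Sup K) - g (Inf K) = 0" by simp
        qed
      qed (use q in auto)
      moreover have "(\<Sum>(x, K)\<in>q'. g (Sup K) - g (Inf K)) \<le> (\<Sum>(x, K)\<in>q'. dist (g (Inf K)) (g (Sup K)))"
        by (rule sum_mono) (auto simp: dist_real_def)
      ultimately show ?thesis by linarith
    qed
    have "g b - g a = (\<Sum>(x, K)\<in>p. g (Sup K) - g (Inf K))"
      using additive_tagged_division_1[OF \<open>a \<le> b\<close> p, of g] by simp
    also have "\<dots> = (\<Sum>(x, K)\<in>p - q. g (Sup K) - g (Inf K)) + (\<Sum>(x, K)\<in>q. g (Sup K) - g (Inf K))"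
      using fin q by (simp add: sum.subset_diff)
    finally show ?thesis using good bad by linarith
  qed
  have "g b - g a \<le> 0 + e" if "e > 0" for e
  proof -
    \<comment> \<open>This scaling makes the two error terms add up to \<open>e\<close>; the added 1
      keeps the denominator positive when \<open>a = b\<close>.\<close>
    have "g b - g a \<le> e / (b - a + 1) * (b - a) + e / (b - a + 1)"
      using that \<open>a \<le> b\<close> by (intro *) simp
    also have "\<dots> = e / (b - a + 1) * (b - a + 1)" by (simp only: distrib_left mult_1_right)
    also have "\<dots> = e" using \<open>a \<le> b\<close> by simp
    finally show ?thesis by simp
  qed
  then have "g b - g a \<le> 0" by (rule field_le_epsilon)
  then show ?thesis by simp
qed

text \<open>The integrating factor \<open>E\<close> turns the differential inequality for a smoothed
  norm into a nonpositive derivative off \<open>N\<close>, and absolute continuity turns that into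
  monotonicity. The hypothesis is phrased with \<open>W s \<bullet> D\<close> so that it makes sense
  where \<open>W\<close> vanishes.\<close>

lemma absolutely_continuous_on_gronwall:
  fixes W :: "real \<Rightarrow> 'a::real_inner"
  assumes ac: "absolutely_continuous_on {0..T} W" and "0 \<le> T" and "0 \<le> K" and N: "negligible N"
    and der: "\<And>s. s \<in> {0..T} - N \<Longrightarrow> \<exists>D. (W has_vector_derivative D) (at s within {0..T}) \<and>
          W s \<bullet> D \<le> l * (norm (W s))\<^sup>2 + K * norm (W s)"
  shows "norm (W T) \<le> exp (l * T) * norm (W 0) + K * integral {0..T} (\<lambda>s. exp (l * (T - s)))"
proof -
  define E where "E = (\<lambda>s. exp (- l * s))"
  define J where "J = (\<lambda>s. integral {0..s} E)"
  define M where "M = exp (\<bar>l\<bar> * T)"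
  have E_le: "norm (E s) \<le> M" if "s \<in> {0..T}" for s
  proof -
    have "- l * s \<le> \<bar>l\<bar> * s" using that by (intro mult_right_mono) auto
    also have "\<dots> \<le> \<bar>l\<bar> * T" using that by (intro mult_left_mono) auto
    finally show ?thesis by (simp add: E_def M_def)
  qed
  have E_der: "(E has_real_derivative - l * E s) (at s within S)" for s S
    unfolding E_def by (auto intro!: derivative_eq_intros)
  have J_der: "(J has_real_derivative E s) (at s within {0..T})" if "s \<in> {0..T}" for s
    unfolding J_def using that
    by (intro integral_has_real_derivative) (auto simp: E_def intro!: continuous_intros)
  have E_lip: "\<bar>E u - E v\<bar> \<le> \<bar>l\<bar> * M * \<bar>u - v\<bar>" if "u \<in> {0..T}" "v \<in> {0..T}" for u v
  proof -
    have "norm (E u - E v) \<le> \<bar>l\<bar> * M * norm (u - v)"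
    proof (rule field_differentiable_bound[OF _ E_der])
      show "norm (- l * E s) \<le> \<bar>l\<bar> * M" if "s \<in> {0..T}" for s
        using mult_left_mono[OF E_le[OF that], of "\<bar>l\<bar>"] by (simp add: abs_mult)
    qed (use that in auto)
    then show ?thesis by simp
  qed
  have J_lip: "\<bar>J u - J v\<bar> \<le> M * \<bar>u - v\<bar>" if "u \<in> {0..T}" "v \<in> {0..T}" for u v
  proof -
    have "norm (J u - J v) \<le> M * norm (u - v)"
      by (rule field_differentiable_bound[OF _ J_der E_le]) (use that in auto)
    then show ?thesis by simp
  qed
  have "bounded (W ` {0..T})"
    by (intro compact_imp_bounded compact_continuous_image compact_Icc
        absolutely_continuous_on_imp_continuous_on ac)
  then obtain H\<^sub>0 where H\<^sub>0: "norm (W s) \<le> H\<^sub>0" if "s \<in> {0..T}" for s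
    unfolding bounded_iff by blast
  have regularized: "norm (W T) \<le> exp (l * T) * (norm (W 0) + K * J T) + exp (l * T) * (1 + \<bar>l\<bar> * J T) * \<eta>"
    if "\<eta> > 0" for \<eta>
  proof -
    \<comment> \<open>The surplus \<open>\<bar>l\<bar> * \<eta>\<close> absorbs the term
      \<open>- l * \<eta>\<^sup>2\<close> that appears when the squared norm of \<open>W\<close> is
      replaced by the square of \<open>h\<close>; the sign of \<open>l\<close> is arbitrary.\<close>
    define c where "c = K + \<bar>l\<bar> * \<eta>"
    \<comment> \<open>The second component makes the norm differentiable also where \<open>W\<close> vanishes.\<close>
    define h where "h = (\<lambda>s. norm (W s, \<eta>))"
    \<comment> \<open>Where \<open>W\<close> has the required derivative, that of
      \<open>\<phi>\<close> is \<open>E\<close> times (h' - l h - c), which the hypothesis makes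
      nonpositive.\<close>
    define \<phi> where "\<phi> = (\<lambda>s. E s * h s - c * J s)"
    have h_sq: "(h s)\<^sup>2 = (norm (W s))\<^sup>2 + \<eta>\<^sup>2" for s
      by (simp add: h_def norm_Pair)
    have h_ge: "norm (W s) \<le> h s" "\<eta> \<le> h s" for s
      using norm_fst_le[of "W s" \<eta>] norm_snd_le[of \<eta> "W s"] \<open>\<eta> > 0\<close> by (simp_all add: h_def)
    have h_pos: "h s > 0" for s using h_ge(2)[of s] \<open>\<eta> > 0\<close> by linarith
    have h_lip: "\<bar>h u - h v\<bar> \<le> dist (W u) (W v)" for u v
    proof -
      have "\<bar>h u - h v\<bar> \<le> norm ((W u, \<eta>) - (W v, \<eta>))"
        unfolding h_def by (rule norm_triangle_ineq3)
      then show ?thesis by (simp add: norm_Pair dist_norm)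
    qed
    have h_le: "h s \<le> norm (W s) + \<eta>" for s
      using norm_Pair_le[of "W s" \<eta>] \<open>\<eta> > 0\<close> by (simp add: h_def)
    have "\<phi> T \<le> \<phi> 0"
    proof (rule absolutely_continuous_on_nonincreasing[OF _ \<open>0 \<le> T\<close> N])
      \<comment> \<open>The two arguments of \<open>max\<close> are the coefficients of
        \<open>dist (W u) (W v)\<close> and of \<open>dist u v\<close> that come out of the product
        rule splitting below.\<close>
      define L where "L = max M (\<bar>l\<bar> * M * (H\<^sub>0 + \<eta>) + c * M)"
      have "c \<ge> 0" using \<open>0 \<le> K\<close> \<open>\<eta> > 0\<close> by (simp add: c_def)
      show "absolutely_continuous_on {0..T} \<phi>"
      proof (rule absolutely_continuous_on_dominated[OF ac])
        fix u v assume uv: "u \<in> {0..T}" "v \<in> {0..T}"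
        have "\<phi> u - \<phi> v = E u * (h u - h v) + (E u - E v) * h v - c * (J u - J v)"
          by (simp add: \<phi>_def algebra_simps)
        then have "\<bar>\<phi> u - \<phi> v\<bar> \<le> \<bar>E u\<bar> * \<bar>h u - h v\<bar> + \<bar>E u - E v\<bar> * \<bar>h v\<bar> + c * \<bar>J u - J v\<bar>"
          using \<open>c \<ge> 0\<close> abs_triangle_ineq4[of "E u * (h u - h v) + (E u - E v) * h v" "c * (J u - J v)"]
            abs_triangle_ineq[of "E u * (h u - h v)" "(E u - E v) * h v"]
          by (simp add: abs_mult)
        also have "\<dots> \<le> M * dist (W u) (W v) + (\<bar>l\<bar> * M * \<bar>u - v\<bar>) * (H\<^sub>0 + \<eta>) + c * (M * \<bar>u - v\<bar>)"
          using E_le[OF uv(1)] h_lip[of u v] E_lip[OF uv] J_lip[OF uv] h_le[of v] H\<^sub>0[OF uv(2)]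
            h_pos[of v] \<open>c \<ge> 0\<close>
          by (intro add_mono mult_mono) (auto simp: M_def)
        also have "\<dots> = M * dist (W u) (W v) + (\<bar>l\<bar> * M * (H\<^sub>0 + \<eta>) + c * M) * dist u v"
          by (simp add: dist_real_def algebra_simps)
        also have "\<dots> \<le> L * dist (W u) (W v) + L * dist u v"
          by (intro add_mono mult_right_mono) (auto simp: L_def)
        finally show "dist (\<phi> u) (\<phi> v) \<le> L * (dist (W u) (W v) + dist u v)"
          by (simp add: dist_real_def distrib_left)
      qed
    next
      fix s assume s: "s \<in> {0..T} - N"
      then obtain D where D: "(W has_vector_derivative D) (at s within {0..T})"
        and le: "W s \<bullet> D \<le> l * (norm (W s))\<^sup>2 + K * norm (W s)" using der by blast
      have "((\<lambda>s. W s \<bullet> W s) has_vector_derivative W s \<bullet> D + D \<bullet> W s) (at s within {0..T})"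
        by (rule bounded_bilinear.has_vector_derivative[OF bounded_bilinear_inner D D])
      then have "((\<lambda>s. W s \<bullet> W s + \<eta>\<^sup>2) has_real_derivative 2 * (W s \<bullet> D)) (at s within {0..T})"
        by (auto simp: has_real_derivative_iff_has_vector_derivative inner_commute
            intro!: derivative_eq_intros)
      then have "((\<lambda>s. sqrt (W s \<bullet> W s + \<eta>\<^sup>2)) has_real_derivative
          inverse (sqrt (W s \<bullet> W s + \<eta>\<^sup>2)) / 2 * (2 * (W s \<bullet> D))) (at s within {0..T})"
        using \<open>\<eta> > 0\<close> by (intro DERIV_chain2[OF DERIV_real_sqrt] add_nonneg_pos) auto
      moreover have "h = (\<lambda>s. sqrt (W s \<bullet> W s + \<eta>\<^sup>2))"
        by (simp add: h_def norm_Pair fun_eq_iff power2_norm_eq_inner)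
      ultimately have "(h has_real_derivative (W s \<bullet> D) / h s) (at s within {0..T})"
        by (simp add: field_simps)
      then have \<phi>_der: "(\<phi> has_real_derivative
          - l * E s * h s + (W s \<bullet> D) / h s * E s - c * E s) (at s within {0..T})"
        unfolding \<phi>_def using E_der[of s "{0..T}"] J_der[of s] s
        by (intro DERIV_diff DERIV_mult DERIV_cmult) auto
      have "W s \<bullet> D \<le> l * (norm (W s))\<^sup>2 + K * h s"
        using le h_ge(1)[of s] \<open>0 \<le> K\<close> mult_left_mono[of "norm (W s)" "h s" K] by linarith
      also have "\<dots> = l * (h s)\<^sup>2 + K * h s - l * \<eta>\<^sup>2" by (simp add: h_sq algebra_simps)
      also have "- l * \<eta>\<^sup>2 \<le> \<bar>l\<bar> * (\<eta> * h s)"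
        using h_ge(2)[of s] \<open>\<eta> > 0\<close> by (intro mult_mono) (auto simp: power2_eq_square)
      then have "l * (h s)\<^sup>2 + K * h s - l * \<eta>\<^sup>2 \<le> (l * h s + c) * h s"
        by (simp add: c_def algebra_simps power2_eq_square)
      finally have "(W s \<bullet> D) / h s \<le> l * h s + c"
        using h_pos[of s] by (simp add: divide_le_eq)
      then have "((W s \<bullet> D) / h s - l * h s - c) * E s \<le> 0"
        by (intro mult_nonpos_nonneg) (auto simp: E_def)
      with \<phi>_der show "\<exists>D\<le>0. (\<phi> has_vector_derivative D) (at s within {0..T})"
        unfolding has_real_derivative_iff_has_vector_derivative
        by (intro exI conjI) (auto simp: algebra_simps)
    qed
    then have "E T * h T \<le> h 0 + c * J T" by (simp add: \<phi>_def E_def J_def)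
    then have "exp (l * T) * (E T * h T) \<le> exp (l * T) * (norm (W 0) + \<eta> + c * J T)"
      using h_le[of 0] by (intro mult_left_mono) auto
    moreover have "exp (l * T) * (E T * h T) = h T"
      by (simp add: E_def mult.assoc[symmetric] exp_add[symmetric])
    ultimately have "norm (W T) \<le> exp (l * T) * (norm (W 0) + \<eta> + c * J T)"
      using h_ge(1)[of T] by linarith
    then show ?thesis by (simp add: c_def algebra_simps)
  qed
  \<comment> \<open>Only the last term of \<open>regularized\<close> depends on \<eta>, and it
    vanishes as \<eta> tends to 0 from the right.\<close>
  have "norm (W T) \<le> exp (l * T) * (norm (W 0) + K * J T)"
  proof (rule tendsto_lowerbound)
    show "((\<lambda>\<eta>. exp (l * T) * (norm (W 0) + K * J T) + exp (l * T) * (1 + \<bar>l\<bar> * J T) * \<eta>)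
        \<longlongrightarrow> exp (l * T) * (norm (W 0) + K * J T)) (at_right 0)"
      by (auto intro!: tendsto_eq_intros)
    show "\<forall>\<^sub>F \<eta> in at_right 0. norm (W T) \<le>
        exp (l * T) * (norm (W 0) + K * J T) + exp (l * T) * (1 + \<bar>l\<bar> * J T) * \<eta>"
      using eventually_at_right_less[of "0::real"] by (rule eventually_mono) (rule regularized)
  qed simp
  moreover have "integral {0..T} (\<lambda>s. exp (l * (T - s))) = exp (l * T) * J T"
  proof -
    have "(\<lambda>s. exp (l * (T - s))) = (\<lambda>s. exp (l * T) * E s)"
      by (simp add: E_def fun_eq_iff exp_add[symmetric] algebra_simps)
    then show ?thesis by (simp add: J_def)
  qed
  ultimately show ?thesis by (simp add: algebra_simps)
qed

subsection \<open>Closed convex regularization\<close>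

text \<open>A half-space is closed and convex, so it contains the closed convex hull of any values
  of \<open>f\<close> lying in it. One small radius therefore decides for the whole
  intersection.\<close>

lemma closed_convex_regularization_inner_le:
  fixes f :: "'a::real_inner \<Rightarrow> 'a"
  assumes D: "D \<in> closed_convex_regularization f M y"
    and le: "\<forall>\<^sub>F x in nhds y. x \<in> M \<longrightarrow> v \<bullet> f x \<le> c"
  shows "v \<bullet> D \<le> c"
proof -
  obtain e where "e > 0" and e: "\<And>x. dist x y < e \<Longrightarrow> x \<in> M \<Longrightarrow> v \<bullet> f x \<le> c"
    using le unfolding eventually_nhds_metric by blast
  \<comment> \<open>Halving the radius places the closed ball inside the open neighbourhood.\<close>
  have "f ` (cball y (e/2) \<inter> M) \<subseteq> {z. v \<bullet> z \<le> c}"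
    using e \<open>e > 0\<close> by (auto simp: dist_commute)
  then have "closure (convex hull (f ` (cball y (e/2) \<inter> M))) \<subseteq> {z. v \<bullet> z \<le> c}"
    by (intro closure_minimal hull_minimal closed_halfspace_le convex_halfspace_le)
  with D \<open>e > 0\<close> show ?thesis
    by (auto simp: closed_convex_regularization_def dest!: bspec[of _ _ "e/2"])
qed

text \<open>This mean value inequality makes the exact solution Lipschitz, since its velocity is a
  value of the bounded field.\<close>

lemma norm_diff_le_of_vector_derivative:
  fixes g :: "real \<Rightarrow> 'a::real_normed_vector"
  assumes "convex S" "\<And>s. s \<in> S \<Longrightarrow> (g has_vector_derivative g' s) (at s within S)"
    and "\<And>s. s \<in> S \<Longrightarrow> norm (g' s) \<le> B" and "u \<in> S" "v \<in> S"
  shows "norm (g u - g v) \<le> B * \<bar>u - v\<bar>"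
proof -
  have "norm (g u - g v) \<le> B * norm (u - v)"
  proof (rule differentiable_bound[OF assms(1)])
    fix s assume s: "s \<in> S"
    then show "(g has_derivative (\<lambda>x. x *\<^sub>R g' s)) (at s within S)"
      using assms(2) by (simp add: has_vector_derivative_def)
    show "onorm (\<lambda>x. x *\<^sub>R g' s) \<le> B"
      using assms(3)[OF s] by (intro onorm_bound) (auto simp: mult.commute[of B] intro!: mult_left_mono
          intro: order_trans[OF norm_ge_zero])
  qed (use assms in auto)
  then show ?thesis by simp
qed

text \<open>
  \<open>F\<close> need not be continuous; its boundedness is what makes the perturbation from \<open>y\<close> to a nearby
  point \<open>x\<close> negligible.
\<close>

lemma one_sided_Lipschitz_closed_convex_regularization:
  fixes F f :: "'a::real_inner \<Rightarrow> 'a"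
  assumes osl: "\<And>x z. (x - z) \<bullet> (F x - F z) \<le> l * (norm (x - z))\<^sup>2"
    and bounded: "\<And>x. norm (F x) \<le> B"
    and error: "\<And>x. x \<in> M \<Longrightarrow> norm (F x - f x) \<le> K"
    and D: "D \<in> closed_convex_regularization f M y"
  shows "(a - y) \<bullet> (F a - D) \<le> l * (norm (a - y))\<^sup>2 + K * norm (a - y)"
proof (rule field_le_epsilon)
  fix e :: real assume "e > 0"
  \<comment> \<open>\<open>\<rho> x\<close> bounds \<open>(a - y) \<bullet> (F a - f x)\<close> for
    \<open>x\<close> in \<open>M\<close>, the last summand paying for \<open>a - y\<close> in place
    of \<open>a - x\<close>. At \<open>x = y\<close> it is the claimed bound, and continuity costs
    only \<open>e\<close>.\<close>
  define \<rho> where "\<rho> = (\<lambda>x. l * (norm (a - x))\<^sup>2 + K * norm (a - x) + norm (x - y) * (2 * B + K))"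
  have "(\<rho> \<longlongrightarrow> \<rho> y) (nhds y)"
    unfolding \<rho>_def by (intro tendsto_intros filterlim_ident)
  then have "\<forall>\<^sub>F x in nhds y. \<rho> x < \<rho> y + e"
    using \<open>e > 0\<close> by (intro order_tendstoD) auto
  then have "\<forall>\<^sub>F x in nhds y. x \<in> M \<longrightarrow> (y - a) \<bullet> f x \<le> \<rho> y + e - (a - y) \<bullet> F a"
  proof (rule eventually_mono, intro impI)
    fix x assume x: "\<rho> x < \<rho> y + e" "x \<in> M"
    have "norm (F a - f x) \<le> 2 * B + K"
      using norm_triangle_ineq[of "F a - F x" "F x - f x"] norm_triangle_ineq4[of "F a" "F x"]
        bounded[of a] bounded[of x] error[OF x(2)] by simp
    then have "(x - y) \<bullet> (F a - f x) \<le> norm (x - y) * (2 * B + K)"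
      by (intro order_trans[OF norm_cauchy_schwarz] mult_left_mono) auto
    moreover have "(a - x) \<bullet> (F x - f x) \<le> K * norm (a - x)"
      using error[OF x(2)] norm_cauchy_schwarz[of "a - x" "F x - f x"]
        mult_left_mono[of "norm (F x - f x)" K "norm (a - x)"] by (simp add: mult.commute)
    \<comment> \<open>The splitting is a - y = (a - x) + (x - y): the one-sided Lipschitz condition
      is used between \<open>a\<close> and \<open>x\<close>, the error bound at \<open>x\<close>,
      and a crude norm bound along the short vector \<open>x - y\<close>.\<close>
    ultimately have "(a - x) \<bullet> (F a - F x) + (a - x) \<bullet> (F x - f x) + (x - y) \<bullet> (F a - f x) \<le> \<rho> x"
      using osl[of a x] by (simp add: \<rho>_def)
    moreover have "(a - x) \<bullet> (F a - F x) + (a - x) \<bullet> (F x - f x) + (x - y) \<bullet> (F a - f x)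
        = (a - y) \<bullet> F a + (y - a) \<bullet> f x"
      by (simp add: algebra_simps)
    ultimately show "(y - a) \<bullet> f x \<le> \<rho> y + e - (a - y) \<bullet> F a" using x(1) by linarith
  qed
  from closed_convex_regularization_inner_le[OF D this]
  have "(a - y) \<bullet> (F a - D) \<le> \<rho> y + e" by (simp add: algebra_simps)
  then show "(a - y) \<bullet> (F a - D) \<le> l * (norm (a - y))\<^sup>2 + K * norm (a - y) + e"
    by (simp add: \<rho>_def)
qed

subsection \<open>The error bound\<close>

text \<open>Well-definedness of \<open>f\<close> enters as its formula holding for every
  factorization of \<open>X\<close>. Although \<open>f\<close> is total, the regularization only
  sees its values on the manifold.\<close>

theorem theorem10:
  fixes F f :: "real^'n^'m \<Rightarrow> real^'n^'m"
    and S\<^sub>U :: "real^'r^'m \<Rightarrow> real^'r^'m" and S\<^sub>V :: "real^'r^'n \<Rightarrow> real^'r^'n"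
    and C\<^sub>m\<^sub>r C\<^sub>n\<^sub>r l \<epsilon>\<^sub>r B T :: real
    and A Y :: "real \<Rightarrow> real^'n^'m" and A\<^sub>0 Y\<^sub>0 :: "real^'n^'m"
  assumes deim_U: "deim_procedure S\<^sub>U C\<^sub>m\<^sub>r"
    and deim_V: "deim_procedure S\<^sub>V C\<^sub>n\<^sub>r"
    and f_well_defined: "\<And>X U \<Sigma> V. low_rank_factorization X U \<Sigma> V \<Longrightarrow>
          f X = deim_projection S\<^sub>U S\<^sub>V U V (F X)"
    and one_sided_Lipschitz: "\<And>X Z. (X - Z) \<bullet> (F X - F Z) \<le> l * (norm (X - Z))\<^sup>2"
    and eps_nonneg: "\<epsilon>\<^sub>r \<ge> 0"
    and small_normal_component: "\<And>X (U :: real^'r^'m) \<Sigma> V. low_rank_factorization X U \<Sigma> V \<Longrightarrow>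
          norm (tangent_projection U V (F X) - F X) \<le> \<epsilon>\<^sub>r"
    and bounded: "\<And>X. norm (F X) \<le> B"
    and A_initial: "A 0 = A\<^sub>0"
    and A_ode: "\<And>t. t \<in> {0..T} \<Longrightarrow> (A has_vector_derivative F (A t)) (at t within {0..T})"
    and Y_initial: "Y\<^sub>0 \<in> fixed_rank CARD('r)"
    and Y_inclusion: "solves_inclusion
          (closed_convex_regularization f (fixed_rank CARD('r))) (fixed_rank CARD('r)) Y\<^sub>0 T Y"
    and t_in: "t \<in> {0..T}"
  shows "norm (A t - Y t) \<le> exp (l * t) * norm (A 0 - Y 0) +
           C\<^sub>m\<^sub>r * C\<^sub>n\<^sub>r * \<epsilon>\<^sub>r * integral {0..t} (\<lambda>s. exp (l * (t - s)))"
proof -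
  let ?M = "fixed_rank CARD('r) :: (real^'n^'m) set"
  define K where "K = C\<^sub>m\<^sub>r * C\<^sub>n\<^sub>r * \<epsilon>\<^sub>r"
  \<comment> \<open>\<open>Y\<^sub>0\<close> supplies matrices with orthonormal columns. Without
    any, \<open>deim_procedure\<close> would be vacuous and would say nothing about the sign of the
    constants.\<close>
  obtain U :: "real^'r^'m" and \<Sigma> and V :: "real^'r^'n" where "low_rank_factorization Y\<^sub>0 U \<Sigma> V"
    using low_rank_factorization_exists[OF Y_initial] .
  then have C: "1 \<le> C\<^sub>m\<^sub>r" "1 \<le> C\<^sub>n\<^sub>r"
    using deim_constant_ge_1 deim_U deim_V by (auto simp: low_rank_factorization_def)
  then have "0 \<le> K" using eps_nonneg by (simp add: K_def)
  have error: "norm (F X - f X) \<le> K" if X: "X \<in> ?M" for X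
  proof -
    obtain U :: "real^'r^'m" and \<Sigma> and V :: "real^'r^'n" where UV: "low_rank_factorization X U \<Sigma> V"
      using low_rank_factorization_exists[OF X] .
    then have "norm (F X - f X) \<le> C\<^sub>m\<^sub>r * C\<^sub>n\<^sub>r * norm (tangent_projection U V (F X) - F X)"
      using norm_deim_projection_error_le[OF deim_U deim_V, of U V "F X"] f_well_defined[OF UV]
      by (simp add: low_rank_factorization_def)
    also have "\<dots> \<le> K"
      unfolding K_def using small_normal_component[OF UV] C by (intro mult_left_mono) auto
    finally show ?thesis .
  qed
  have sub: "{0..t} \<subseteq> {0..T}" using t_in by auto
  have Y_ac: "absolutely_continuous_on {0..T} Y"
    and Y_AE: "AE s in lebesgue_on {0..T}. \<exists>D. (Y has_vector_derivative D) (at s within {0..T}) \<and>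
      D \<in> closed_convex_regularization f ?M (Y s)"
    using Y_inclusion by (simp_all add: solves_inclusion_def)
  from Y_AE obtain N where N_null: "N \<in> null_sets (lebesgue_on {0..T})"
    and Y_der': "{s \<in> space (lebesgue_on {0..T}). \<not> (\<exists>D. (Y has_vector_derivative D) (at s within {0..T}) \<and>
      D \<in> closed_convex_regularization f ?M (Y s))} \<subseteq> N"
    unfolding eventually_ae_filter by blast
  have N: "negligible N"
    using N_null by (simp add: null_sets_restrict_space negligible_iff_null_sets)
  have Y_der: "\<exists>D. (Y has_vector_derivative D) (at s within {0..T}) \<and>
      D \<in> closed_convex_regularization f ?M (Y s)" if "s \<in> {0..T} - N" for s
    using Y_der' that by auto
  \<comment> \<open>The Gronwall estimate is stated at the right end point, hence the restriction to
    \<open>{0..t}\<close>.\<close>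
  have "norm (A t - Y t) \<le> exp (l * t) * norm (A 0 - Y 0) + K * integral {0..t} (\<lambda>s. exp (l * (t - s)))"
  proof (rule absolutely_continuous_on_gronwall[OF _ _ \<open>0 \<le> K\<close> N])
    \<comment> \<open>\<open>A\<close> is Lipschitz with constant \<open>B\<close>, so increments of
      the difference are dominated by those of \<open>Y\<close> and of time; \<open>max B 1\<close>
      serves both.\<close>
    have "absolutely_continuous_on {0..T} (\<lambda>s. A s - Y s)"
    proof (rule absolutely_continuous_on_dominated[OF Y_ac])
      fix u v assume uv: "u \<in> {0..T}" "v \<in> {0..T}"
      have "dist (A u - Y u) (A v - Y v) \<le> norm (A u - A v) + dist (Y u) (Y v)"
        using norm_triangle_ineq4[of "A u - A v" "Y u - Y v"] by (simp add: dist_norm algebra_simps)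
      also have "\<dots> \<le> B * dist u v + dist (Y u) (Y v)"
        using norm_diff_le_of_vector_derivative[OF _ A_ode bounded uv] by (simp add: dist_real_def)
      also have "\<dots> \<le> max B 1 * dist u v + max B 1 * dist (Y u) (Y v)"
        using mult_right_mono[of 1 "max B 1" "dist (Y u) (Y v)"] by (intro add_mono mult_right_mono) auto
      finally show "dist (A u - Y u) (A v - Y v) \<le> max B 1 * (dist (Y u) (Y v) + dist u v)"
        by (simp add: distrib_left)
    qed
    then show "absolutely_continuous_on {0..t} (\<lambda>s. A s - Y s)"
      using absolutely_continuous_on_subset sub by blast
    show "0 \<le> t" using t_in by simp
    fix s assume s: "s \<in> {0..t} - N"
    with sub obtain D where D: "(Y has_vector_derivative D) (at s within {0..T})"
      "D \<in> closed_convex_regularization f ?M (Y s)" using Y_der by blast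
    have "((\<lambda>s. A s - Y s) has_vector_derivative F (A s) - D) (at s within {0..t})"
      using s sub by (intro has_vector_derivative_diff has_vector_derivative_within_subset[OF D(1) sub]
          has_vector_derivative_within_subset[OF A_ode sub]) auto
    then show "\<exists>D. ((\<lambda>s. A s - Y s) has_vector_derivative D) (at s within {0..t}) \<and>
        (A s - Y s) \<bullet> D \<le> l * (norm (A s - Y s))\<^sup>2 + K * norm (A s - Y s)"
      using one_sided_Lipschitz_closed_convex_regularization[OF one_sided_Lipschitz bounded error D(2)]
      by blast
  qed
  then show ?thesis by (simp add: K_def)
qed

end
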